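(* Let $n\geq 5$ and let $G$ be a graph on $n$ vertices such that both $G$ and its complement $\overline{G}$ are connected. Then $rvc(G)+rvc(\overline{G})\leq n-1$. Moreover, this bound is best possible: for every $n\geq 5$ there is a graph $G$ on $n$ vertices with $G$ and $\overline{G}$ both connected and $rvc(G)+rvc(\overline{G})=n-1$.
   Context: All graphs are finite, simple and undirected. A vertex-coloring of a graph (not necessarily proper) makes the graph rainbow vertex-connected if every pair of distinct vertices is joined by a path whose internal vertices have pairwise distinct colors. For a connected graph $G$, the rainbow vertex-connection number $rvc(G)$ is the minimum number of colors in a vertex-coloring making $G$ rainbow vertex-connected (so $rvc(G)=0$ exactly when $G$ is complete). $\overline{G}$ denotes the complement of $G$. *)

theory Defs
  imports
    "Graph_Theory.Vertex_Walk"
    "Graph_Theory.Digraph_Component"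
    "Graph_Theory.Kuratowski"
begin

text \<open>A finite simple undirected graph is a symmetric, loop-free, finite
  pair digraph, i.e. the locale predicate \<^const>\<open>pair_graph\<close>.\<close>

definition graph_complement :: "'a pair_pre_digraph \<Rightarrow> 'a pair_pre_digraph" where
  "graph_complement G =
     \<lparr> pverts = pverts G,
       parcs = {(u, v). u \<in> pverts G \<and> v \<in> pverts G \<and> u \<noteq> v \<and> (u, v) \<notin> parcs G} \<rparr>"

text \<open>A path is given by its list \<open>p\<close> of vertices (which are distinct, by \<^const>\<open>vpath\<close>);
  \<open>butlast (tl p)\<close> lists its internal vertices. The colouring \<open>c\<close> need not be proper.\<close>

definition rainbow_vertex_connected :: "'a pair_pre_digraph \<Rightarrow> ('a \<Rightarrow> nat) \<Rightarrow> bool" where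
  "rainbow_vertex_connected G c \<longleftrightarrow>
     (\<forall>u \<in> pverts G. \<forall>v \<in> pverts G. u \<noteq> v \<longrightarrow>
        (\<exists>p. vpath p (with_proj G) \<and> hd p = u \<and> last p = v \<and>
             distinct (map c (butlast (tl p)))))"

text \<open>Only meaningful for connected \<open>G\<close>: otherwise no colouring qualifies and
  the \<open>LEAST\<close> is unspecified. A colouring of all vertices of a nonempty graph uses
  at least one colour; the convention that complete graphs need no colours (no path has to
  have internal vertices) is therefore a separate case.\<close>

definition rvc :: "'a pair_pre_digraph \<Rightarrow> nat" where
  "rvc G =
     (if complete_digraph (card (pverts G)) (with_proj G) then 0
      else (LEAST k. \<exists>c. card (c ` pverts G) = k \<and> rainbow_vertex_connected G c))"

lemma pair_graph_complement:
  assumes "pair_graph G"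
  shows "pair_graph (graph_complement G)"
proof -
  interpret pair_graph G by fact
  have "finite (parcs (graph_complement G))"
    by (rule finite_subset[of _ "pverts G \<times> pverts G"])
       (auto simp: graph_complement_def pair_finite_verts)
  moreover have "sym (parcs (graph_complement G))"
    using pair_sym_arcs by (auto simp: graph_complement_def sym_def symmetric_def)
  ultimately show ?thesis
    by unfold_locales
       (auto simp: graph_complement_def pair_finite_verts symmetric_def)
qed

lemma graph_complement_complement:
  assumes "pair_graph G"
  shows "graph_complement (graph_complement G) = G"
proof -
  interpret pair_graph G by fact
  show ?thesis
    using arc_fst_in_verts arc_snd_in_verts pair_no_loops
    by (cases G) (fastforce simp: graph_complement_def)
qed

lemma ex_rainbow_vertex_connected:
  assumes "pair_graph G" and "Digraph_Component.connected (with_proj G)"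
  shows "\<exists>c. rainbow_vertex_connected G c"
proof -
  interpret pair_graph G by fact
  obtain c :: "'a \<Rightarrow> nat" where c: "inj_on c (pverts G)"
    using pair_finite_verts finite_imp_inj_to_nat_seg by metis
  have "\<exists>p. vpath p (with_proj G) \<and> hd p = u \<and> last p = v \<and> distinct (map c (butlast (tl p)))"
    if "u \<in> pverts G" "v \<in> pverts G" for u v
  proof -
    have "u \<rightarrow>\<^sup>*\<^bsub>with_proj G\<^esub> v"
      using assms(2) that reachable_mk_symmetric_eq[OF pair_sym_arcs]
      by (simp add: Digraph_Component.connected_def strongly_connected_def)
    then obtain w where "vwalk w (with_proj G)" "hd w = u" "last w = v"
      by (metis reachable_vwalk_conv)
    then obtain p where p: "vpath p (with_proj G)" "hd p = u" "last p = v"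
      using vwalk_imp_ex_vpath by metis
    have "set (butlast (tl p)) \<subseteq> pverts G"
      using p(1) by (auto simp: vpath_def vwalk_def dest!: in_set_butlastD list.set_sel(2)[rotated])
    then have "distinct (map c (butlast (tl p)))"
      using p(1) c
      by (auto simp: distinct_map vpath_def intro: distinct_butlast distinct_tl inj_on_subset)
    then show ?thesis using p by blast
  qed
  then show ?thesis unfolding rainbow_vertex_connected_def by blast
qed

lemma rvc_eq_0_iff:
  assumes "pair_graph G" and "Digraph_Component.connected (with_proj G)"
  shows "rvc G = 0 \<longleftrightarrow> complete_digraph (card (pverts G)) (with_proj G)"
proof (cases "complete_digraph (card (pverts G)) (with_proj G)")
  case False
  interpret pair_graph G by fact
  let ?P = "\<lambda>k. \<exists>c. card (c ` pverts G) = k \<and> rainbow_vertex_connected G c"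
  have "\<exists>k. ?P k" using ex_rainbow_vertex_connected[OF assms] by blast
  then have "?P (LEAST k. ?P k)" by (rule LeastI_ex)
  then obtain c :: "'a \<Rightarrow> nat" where "card (c ` pverts G) = rvc G"
    using False by (auto simp: rvc_def)
  moreover have "pverts G \<noteq> {}"
    using assms(2) by (simp add: Digraph_Component.connected_def strongly_connected_def)
  ultimately have "rvc G \<noteq> 0"
    using pair_finite_verts by (metis card_0_eq finite_imageI image_is_empty)
  with False show ?thesis by simp
qed (simp add: rvc_def)

end

theory Submission
  imports Defs
begin

text \<open>A connected dominating set \<open>S\<close> gives \<open>rvc G \<le> |S|\<close>: colour \<open>S\<close> injectively,
  because any two vertices are joined by a path with all internal vertices in \<open>S\<close>. A connected
  graph on \<open>n \<ge> 3\<close> vertices has such a set of size at most \<open>n - 2\<close>. If \<open>G\<close> has diameter at most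
  \<open>2\<close>, then \<open>rvc G \<le> 1\<close>; if not, two vertices at distance at least \<open>3\<close> form a connected
  dominating set of the complement, whose \<open>rvc\<close> is thus at most \<open>2\<close>. So the sum is at most
  \<open>1 + (n - 2)\<close> if one of the diameters is at most \<open>2\<close>, and at most \<open>2 + 2 \<le> n - 1\<close> otherwise.
  Equality holds for the path on \<open>n\<close> vertices.\<close>

section \<open>Connected dominating sets and paths inside a vertex set\<close>

text \<open>The dominated set \<open>W\<close> is a parameter because the pair \<open>S\<close>,
  \<open>W\<close> is later grown one vertex at a time until \<open>W\<close> contains every
  vertex.\<close>

definition connected_dominating :: "'a rel \<Rightarrow> 'a set \<Rightarrow> 'a set \<Rightarrow> bool" where
  "connected_dominating E S W \<longleftrightarrow>
     S \<noteq> {} \<and> S \<subseteq> W \<and> (\<forall>s\<in>S. \<forall>t\<in>S. (s, t) \<in> (Restr E S)\<^sup>*) \<and>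
     (\<forall>w\<in>W - S. \<exists>s\<in>S. (w, s) \<in> E)"

lemma (in pair_graph) parcs_sym: "(u, v) \<in> parcs G \<Longrightarrow> (v, u) \<in> parcs G"
  using pair_sym_arcs by (auto simp: symmetric_def dest: symD)

text \<open>The arcs are symmetric, so passing to \<open>mk_symmetric\<close> adds no reachability;
  connectedness can then be handled by induction over \<open>rtrancl\<close>.\<close>

lemma (in pair_graph) connected_rtrancl_iff:
  "Digraph_Component.connected (with_proj G) \<longleftrightarrow>
     pverts G \<noteq> {} \<and> (\<forall>u\<in>pverts G. \<forall>v\<in>pverts G. (u, v) \<in> (parcs G)\<^sup>*)"
proof -
  have "u \<rightarrow>\<^sup>*\<^bsub>with_proj G\<^esub> v \<longleftrightarrow> (u, v) \<in> (parcs G)\<^sup>*" if "u \<in> pverts G" "v \<in> pverts G" for u v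
    using that by (auto simp: reachable_conv)
  then show ?thesis
    by (simp add: Digraph_Component.connected_def strongly_connected_def
        reachable_mk_symmetric_eq[OF pair_sym_arcs])
qed

text \<open>Prepending arcs gives a walk inside \<open>T\<close>, and shortening a walk to a path
  introduces no new vertices.\<close>

lemma (in pair_graph) rtrancl_imp_vpath:
  assumes "(u, v) \<in> (Restr (parcs G) T)\<^sup>*" and "u \<in> pverts G" and "u \<in> T"
  shows "\<exists>p. vpath p (with_proj G) \<and> hd p = u \<and> last p = v \<and> set p \<subseteq> T"
proof -
  have "u \<in> pverts G \<and> u \<in> T \<longrightarrow>
      (\<exists>p. vwalk p (with_proj G) \<and> hd p = u \<and> last p = v \<and> set p \<subseteq> T)"
    using assms(1)
  proof (induction rule: converse_rtrancl_induct)
    case base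
    show ?case by (intro impI exI[of _ "[v]"]) auto
  next
    case (step y z)
    then obtain p where p: "vwalk p (with_proj G)" "hd p = z" "last p = v" "set p \<subseteq> T"
      using in_arcsD2 by auto
    then have "vwalk (y # p) (with_proj G)"
      using step(1) in_arcsD1 by (auto intro!: vwalk_consI)
    moreover have "p \<noteq> []" using p(1) by auto
    ultimately show ?case using p step(1) by (intro impI exI[of _ "y # p"]) auto
  qed
  then obtain p where p: "vwalk p (with_proj G)" "hd p = u" "last p = v" "set p \<subseteq> T"
    using assms by blast
  have "set (vwalk_to_vpath p) \<subseteq> T" using p(4) vwalk_to_vpath_subset by fastforce
  then show ?thesis
    using vwalk_to_vpath_vpath[OF p(1)] vwalk_to_vpath_hd[of p] vwalk_to_vpath_last[of p] p
    by metis
qed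

section \<open>Upper bounds on \<open>rvc\<close> by explicit colourings\<close>

lemma rvc_le:
  assumes "rainbow_vertex_connected G c"
  shows "rvc G \<le> card (c ` pverts G)"
  using assms by (auto simp: rvc_def intro!: Least_le)

text \<open>Distinctness keeps both ends from recurring in the interior, so only \<open>S\<close> is
  left for the internal vertices.\<close>

lemma internal_vertices_subset:
  assumes "distinct p" and "set p \<subseteq> S \<union> {hd p, last p}"
  shows "set (butlast (tl p)) \<subseteq> S"
proof (cases "tl p = []")
  case False
  then have ne: "p \<noteq> []" by auto
  have "last (tl p) = last p" using False by (simp add: last_tl)
  then have "tl p = butlast (tl p) @ [last p]"
    using append_butlast_last_id[OF False] by simp
  then have p: "p = hd p # butlast (tl p) @ [last p]" using ne by (metis list.collapse)
  then have "distinct (hd p # butlast (tl p) @ [last p])" using assms(1) by metis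
  then have "hd p \<notin> set (butlast (tl p))" "last p \<notin> set (butlast (tl p))" by auto
  moreover have "set (butlast (tl p)) \<subseteq> set p"
    by (metis in_set_butlastD list.set_sel(2) ne subsetI)
  ultimately show ?thesis using assms(2) by blast
qed simp

lemma (in pair_graph) rvc_le_card_connected_dominating:
  assumes "connected_dominating (parcs G) S (pverts G)"
  shows "rvc G \<le> card S"
proof -
  have S: "S \<noteq> {}" "S \<subseteq> pverts G" and conn: "\<And>s t. s \<in> S \<Longrightarrow> t \<in> S \<Longrightarrow> (s, t) \<in> (Restr (parcs G) S)\<^sup>*"
    and dom: "\<And>w. w \<in> pverts G \<Longrightarrow> w \<notin> S \<Longrightarrow> \<exists>s\<in>S. (w, s) \<in> parcs G"
    using assms by (auto simp: connected_dominating_def)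
  have fin: "finite S" using S(2) pair_finite_verts by (rule finite_subset)
  obtain s0 where s0: "s0 \<in> S" using S(1) by blast
  obtain e :: "'a \<Rightarrow> nat" where e: "inj_on e S"
    using finite_imp_inj_to_nat_seg[OF fin] by blast
  \<comment> \<open>Vertices outside \<open>S\<close> reuse the colour of \<open>s0\<close>, so they
    add no colour to those of \<open>S\<close>.\<close>
  define c where "c x = (if x \<in> S then e x else e s0)" for x
  have inj: "inj_on c S" using e by (auto simp: c_def inj_on_def)
  have "rainbow_vertex_connected G c"
    unfolding rainbow_vertex_connected_def
  proof (intro ballI impI)
    fix u v assume uv: "u \<in> pverts G" "v \<in> pverts G" "u \<noteq> v"
    let ?T = "S \<union> {u, v}"
    \<comment> \<open>Each end lies in \<open>S\<close> or one arc away from it. A path inside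
      \<open>?T\<close> is therefore found by entering \<open>S\<close> at \<open>s\<close>,
      crossing it, and leaving it at \<open>t\<close>.\<close>
    have near: "\<exists>s\<in>S. (w, s) \<in> (Restr (parcs G) ?T)\<^sup>* \<and> (s, w) \<in> (Restr (parcs G) ?T)\<^sup>*"
      if "w \<in> {u, v}" for w
    proof (cases "w \<in> S")
      case True
      then show ?thesis by (intro bexI[of _ w] conjI rtrancl_refl)
    next
      case False
      moreover have "w \<in> pverts G" using that uv by auto
      ultimately obtain s where s: "s \<in> S" "(w, s) \<in> parcs G" using dom[of w] by auto
      then have "(w, s) \<in> Restr (parcs G) ?T" "(s, w) \<in> Restr (parcs G) ?T"
        using that parcs_sym[OF s(2)] by auto
      then show ?thesis using s(1) by (intro bexI[of _ s] conjI r_into_rtrancl)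
    qed
    obtain s where s: "s \<in> S" "(u, s) \<in> (Restr (parcs G) ?T)\<^sup>*"
      using near[of u] by (metis insertI1)
    obtain t where t: "t \<in> S" "(t, v) \<in> (Restr (parcs G) ?T)\<^sup>*"
      using near[of v] by (metis insertI1 insertI2)
    have "(s, t) \<in> (Restr (parcs G) ?T)\<^sup>*"
      using conn[OF s(1) t(1)] by (rule rtrancl_mono[THEN subsetD, rotated]) auto
    then have "(u, v) \<in> (Restr (parcs G) ?T)\<^sup>*" using s t by (meson rtrancl_trans)
    then obtain p where p: "vpath p (with_proj G)" "hd p = u" "last p = v" "set p \<subseteq> ?T"
      using rtrancl_imp_vpath uv by blast
    then have "set (butlast (tl p)) \<subseteq> S"
      by (intro internal_vertices_subset) auto
    moreover have "distinct (butlast (tl p))"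
      using p(1) by (auto simp: vpath_def intro: distinct_butlast distinct_tl)
    ultimately have "distinct (map c (butlast (tl p)))"
      using inj by (auto simp: distinct_map intro: inj_on_subset)
    then show "\<exists>p. vpath p (with_proj G) \<and> hd p = u \<and> last p = v \<and>
        distinct (map c (butlast (tl p)))"
      using p by blast
  qed
  then have "rvc G \<le> card (c ` pverts G)" by (rule rvc_le)
  also have "\<dots> \<le> card (e ` S)"
    using s0 fin by (intro card_mono) (auto simp: c_def)
  also have "\<dots> \<le> card S" using fin by (rule card_image_le)
  finally show ?thesis .
qed

text \<open>Diameter at most 2 gives paths with at most one internal vertex, for which a constant
  colouring is already rainbow.\<close>

lemma (in pair_graph) rvc_le_1:
  assumes "\<And>u v. \<lbrakk>u \<in> pverts G; v \<in> pverts G; u \<noteq> v; (u, v) \<notin> parcs G\<rbrakk>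
             \<Longrightarrow> \<exists>w. (u, w) \<in> parcs G \<and> (w, v) \<in> parcs G"
  shows "rvc G \<le> 1"
proof -
  have "rainbow_vertex_connected G (\<lambda>_. 0)"
    unfolding rainbow_vertex_connected_def
  proof (intro ballI impI)
    fix u v assume uv: "u \<in> pverts G" "v \<in> pverts G" "u \<noteq> v"
    show "\<exists>p. vpath p (with_proj G) \<and> hd p = u \<and> last p = v \<and>
        distinct (map (\<lambda>_. 0 :: nat) (butlast (tl p)))"
    proof (cases "(u, v) \<in> parcs G")
      case True
      then show ?thesis using uv by (intro exI[of _ "[u, v]"]) (auto simp: vpath_def vwalk_def)
    next
      case False
      then obtain w where w: "(u, w) \<in> parcs G" "(w, v) \<in> parcs G" using assms uv by blast
      then have "w \<in> pverts G" "w \<noteq> u" "w \<noteq> v" using in_arcsD1 pair_no_loops by fastforce+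
      then show ?thesis
        using uv w by (intro exI[of _ "[u, w, v]"]) (auto simp: vpath_def vwalk_def)
    qed
  qed
  then have "rvc G \<le> card ((\<lambda>_. 0 :: nat) ` pverts G)" by (rule rvc_le)
  also have "\<dots> \<le> card {0 :: nat}" by (intro card_mono) auto
  finally show ?thesis by simp
qed

text \<open>No vertex is adjacent to both \<open>u\<close> and \<open>v\<close> in \<open>G\<close>,
  so every other vertex is adjacent to one of them in the complement. As \<open>u\<close> and
  \<open>v\<close> are adjacent there too, \<open>{u, v}\<close> is a connected dominating
  set.\<close>

lemma (in pair_graph) rvc_complement_le_2:
  assumes "u \<in> pverts G" "v \<in> pverts G" "u \<noteq> v" "(u, v) \<notin> parcs G"
    and "\<And>w. (u, w) \<in> parcs G \<Longrightarrow> (w, v) \<notin> parcs G"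
  shows "rvc (graph_complement G) \<le> 2"
proof -
  interpret C: pair_graph "graph_complement G"
    by (rule pair_graph_complement) unfold_locales
  have "(v, u) \<notin> parcs G" using assms(4) parcs_sym by blast
  then have arcs: "(u, v) \<in> Restr (parcs (graph_complement G)) {u, v}"
    "(v, u) \<in> Restr (parcs (graph_complement G)) {u, v}"
    using assms(1-4) by (auto simp: graph_complement_def)
  have "connected_dominating (parcs (graph_complement G)) {u, v} (pverts (graph_complement G))"
    using assms arcs parcs_sym
    by (auto simp: connected_dominating_def)
       (auto simp: graph_complement_def)
  from C.rvc_le_card_connected_dominating[OF this] show ?thesis using assms(3) by simp
qed

section \<open>Connected dominating sets of size at most n - 2\<close>

text \<open>Without such an arc, \<open>W\<close> would be closed under reachability and hence
  contain every vertex.\<close>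

lemma (in pair_graph) connected_cut_arc:
  assumes "Digraph_Component.connected (with_proj G)" and "W \<subset> pverts G" and "W \<noteq> {}"
  shows "\<exists>t\<in>W. \<exists>w\<in>pverts G - W. (t, w) \<in> parcs G"
proof (rule ccontr)
  assume none: "\<not> ?thesis"
  obtain x y where xy: "x \<in> W" "y \<in> pverts G - W" using assms by blast
  then have "(x, y) \<in> (parcs G)\<^sup>*" using assms connected_rtrancl_iff by blast
  then have "y \<in> W"
    by (induction rule: rtrancl_induct) (use xy none in_arcsD2 in blast)+
  then show False using xy by blast
qed

text \<open>The new vertex \<open>w\<close> is dominated by \<open>t\<close>. Since \<open>t\<close>
  lies in \<open>W\<close>, it is in \<open>S\<close> or adjacent to \<open>S\<close>, so adding it
  keeps \<open>S\<close> connected.\<close>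

lemma (in pair_graph) connected_dominating_insert:
  assumes "connected_dominating (parcs G) S W" and "t \<in> W" and "(t, w) \<in> parcs G"
  shows "connected_dominating (parcs G) (insert t S) (insert w W)"
proof -
  have S: "S \<noteq> {}" "S \<subseteq> W" and conn: "\<And>s t. s \<in> S \<Longrightarrow> t \<in> S \<Longrightarrow> (s, t) \<in> (Restr (parcs G) S)\<^sup>*"
    and dom: "\<And>w. w \<in> W \<Longrightarrow> w \<notin> S \<Longrightarrow> \<exists>s\<in>S. (w, s) \<in> parcs G"
    using assms by (auto simp: connected_dominating_def)
  let ?R = "Restr (parcs G) (insert t S)"
  have conn': "(a, b) \<in> ?R\<^sup>*" if "a \<in> S" "b \<in> S" for a b
    using conn[OF that] by (rule rtrancl_mono[THEN subsetD, rotated]) auto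
  \<comment> \<open>\<open>s\<close> serves as a hub: it is \<open>t\<close> itself or a neighbour
    of \<open>t\<close> in \<open>S\<close>, and any two vertices of \<open>insert t S\<close> are
    joined through it.\<close>
  obtain s where s: "s \<in> S" "(t, s) \<in> ?R\<^sup>*" "(s, t) \<in> ?R\<^sup>*"
  proof (cases "t \<in> S")
    case False
    then obtain s where "s \<in> S" "(t, s) \<in> parcs G" using dom assms(2) by blast
    then show ?thesis using that parcs_sym by blast
  qed blast
  have "(a, b) \<in> ?R\<^sup>*" if "a \<in> insert t S" "b \<in> insert t S" for a b
  proof -
    have "(a, s) \<in> ?R\<^sup>*" using that(1) s conn' by blast
    moreover have "(s, b) \<in> ?R\<^sup>*" using that(2) s conn' by blast
    ultimately show ?thesis by (rule rtrancl_trans)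
  qed
  moreover have "\<exists>s\<in>insert t S. (v, s) \<in> parcs G" if "v \<in> insert w W - insert t S" for v
    using that dom[of v] parcs_sym[OF assms(3)] by auto
  moreover have "insert t S \<subseteq> insert w W" using S(2) assms(2) by auto
  ultimately show ?thesis unfolding connected_dominating_def by simp
qed

text \<open>Start from the middle vertex of a three-vertex path. Each step adds one vertex to
  \<open>W\<close> and at most one to \<open>S\<close>, so the gap of 2 persists.\<close>

lemma (in pair_graph) ex_connected_dominating:
  assumes conn: "Digraph_Component.connected (with_proj G)" and "3 \<le> k" and "k \<le> card (pverts G)"
  shows "\<exists>S W. connected_dominating (parcs G) S W \<and> W \<subseteq> pverts G \<and> card W = k \<and> card S \<le> k - 2"
  using assms(2,3)
proof (induction k rule: dec_induct)
  case base
  have "pverts G \<noteq> {}" using base by auto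
  then obtain x where x: "x \<in> pverts G" by blast
  have "card {x} \<noteq> card (pverts G)" using base by simp
  then have "{x} \<noteq> pverts G" by metis
  then have "{x} \<subset> pverts G" using x by blast
  then obtain y where y: "y \<in> pverts G" "y \<noteq> x" "(x, y) \<in> parcs G"
    using connected_cut_arc[OF conn, of "{x}"] by auto
  have "card {x, y} \<noteq> card (pverts G)" using y base by simp
  then have "{x, y} \<noteq> pverts G" by metis
  then have "{x, y} \<subset> pverts G" using x y by blast
  then obtain t z where z: "t \<in> {x, y}" "z \<in> pverts G - {x, y}" "(t, z) \<in> parcs G"
    using connected_cut_arc[OF conn, of "{x, y}"] by blast
  \<comment> \<open>\<open>z\<close> hangs on \<open>x\<close> or on \<open>y\<close>; the one it
    hangs on is \<open>t\<close>, adjacent to both other vertices.\<close>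
  then have "connected_dominating (parcs G) {t} {x, y, z}"
    using y parcs_sym by (auto simp: connected_dominating_def)
  moreover have "card {x, y, z} = 3" using y z by auto
  ultimately show ?case using x y z
    by (intro exI[of _ "{t}"] exI[of _ "{x, y, z}"]) auto
next
  case (step k)
  then obtain S W where SW: "connected_dominating (parcs G) S W" "W \<subseteq> pverts G" "card W = k"
    "card S \<le> k - 2"
    by auto
  have "W \<subset> pverts G" using SW step by auto
  moreover have "W \<noteq> {}" using SW step by auto
  ultimately obtain t w where tw: "t \<in> W" "w \<in> pverts G - W" "(t, w) \<in> parcs G"
    using connected_cut_arc[OF conn] by blast
  have "card (insert w W) = Suc k"
    using tw SW finite_subset[OF SW(2) pair_finite_verts] by simp
  \<comment> \<open>As \<open>k\<close> is at least 3, the subtraction does not truncate and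
    \<open>Suc k - 2\<close> exceeds \<open>k - 2\<close> by one.\<close>
  moreover have "card (insert t S) \<le> Suc k - 2"
    using SW(4) card_insert_le_m1[of "Suc k - 2" S t] step by simp
  ultimately show ?case
    using connected_dominating_insert[OF SW(1) tw(1,3)] SW(2) tw(2)
    by (intro exI[of _ "insert t S"] exI[of _ "insert w W"]) auto
qed

lemma (in pair_graph) rvc_le_card_verts_diff_2:
  assumes "Digraph_Component.connected (with_proj G)" and "3 \<le> card (pverts G)"
  shows "rvc G \<le> card (pverts G) - 2"
proof -
  obtain S W where SW: "connected_dominating (parcs G) S W" "W \<subseteq> pverts G"
    "card W = card (pverts G)" "card S \<le> card (pverts G) - 2"
    using ex_connected_dominating[OF assms] by blast
  then have "W = pverts G" using pair_finite_verts by (metis card_subset_eq)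
  then show ?thesis using rvc_le_card_connected_dominating SW by fastforce
qed

section \<open>The upper bound on the sum\<close>

lemma rvc_add_rvc_complement_le:
  assumes G: "pair_graph G" and n: "card (pverts G) \<ge> 5"
    and conn: "Digraph_Component.connected (with_proj G)"
    and conn': "Digraph_Component.connected (with_proj (graph_complement G))"
  shows "rvc G + rvc (graph_complement G) \<le> card (pverts G) - 1"
proof -
  \<comment> \<open>Diameter at most 2, as a predicate on graphs so that it applies to the
    complement as well.\<close>
  let ?diam2 = "\<lambda>G. \<forall>u v. u \<in> pverts G \<and> v \<in> pverts G \<and> u \<noteq> v \<and> (u, v) \<notin> parcs G \<longrightarrow>
      (\<exists>w. (u, w) \<in> parcs G \<and> (w, v) \<in> parcs G)"
  interpret pair_graph G by fact
  interpret C: pair_graph "graph_complement G" using G by (rule pair_graph_complement)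
  have verts: "pverts (graph_complement G) = pverts G" by (simp add: graph_complement_def)
  have le: "rvc G \<le> card (pverts G) - 2" "rvc (graph_complement G) \<le> card (pverts G) - 2"
    using rvc_le_card_verts_diff_2[OF conn] C.rvc_le_card_verts_diff_2[OF conn'] n
    by (simp_all add: verts)
  consider "?diam2 G" | "?diam2 (graph_complement G)"
    | "\<not> ?diam2 G" "\<not> ?diam2 (graph_complement G)" by blast
  then show ?thesis
  proof cases
    case 1
    then have "rvc G \<le> 1" by (intro rvc_le_1) blast
    then show ?thesis using le n by simp
  next
    case 2
    then have "rvc (graph_complement G) \<le> 1" by (intro C.rvc_le_1) blast
    then show ?thesis using le n by simp
  next
    case 3
    then have "rvc (graph_complement G) \<le> 2" using rvc_complement_le_2 by blast
    \<comment> \<open>The same argument in the complement bounds \<open>rvc G\<close>, by double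
      complementation. The total 4 is at most n - 1 because n is at least 5.\<close>
    moreover have "rvc (graph_complement (graph_complement G)) \<le> 2"
      using 3 C.rvc_complement_le_2 by blast
    ultimately show ?thesis using n graph_complement_complement[OF G] by simp
  qed
qed

section \<open>Sharpness: the path and its complement\<close>

definition path_graph :: "nat \<Rightarrow> nat pair_pre_digraph" where
  "path_graph n =
     \<lparr> pverts = {..<n}, parcs = {(i, j). i < n \<and> j < n \<and> (j = Suc i \<or> i = Suc j)} \<rparr>"

lemma pair_graph_path_graph: "pair_graph (path_graph n)"
proof -
  have "finite (parcs (path_graph n))"
    by (rule finite_subset[of _ "{..<n} \<times> {..<n}"]) (auto simp: path_graph_def)
  moreover have "sym (parcs (path_graph n))" by (auto simp: path_graph_def sym_def)
  ultimately show ?thesis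
    by unfold_locales (auto simp: path_graph_def symmetric_def)
qed

lemma connected_path_graph:
  assumes "n > 0"
  shows "Digraph_Component.connected (with_proj (path_graph n))"
proof -
  interpret pair_graph "path_graph n" by (rule pair_graph_path_graph)
  \<comment> \<open>Every vertex is linked with the end 0 in both directions, so 0 joins any two
    vertices.\<close>
  have 0: "(0, i) \<in> (parcs (path_graph n))\<^sup>* \<and> (i, 0) \<in> (parcs (path_graph n))\<^sup>*" if "i < n" for i
    using that
  proof (induction i)
    case (Suc i)
    then have "(i, Suc i) \<in> parcs (path_graph n)" "(Suc i, i) \<in> parcs (path_graph n)"
      by (auto simp: path_graph_def)
    then show ?case using Suc
      by (meson Suc_lessD converse_rtrancl_into_rtrancl rtrancl.rtrancl_into_rtrancl)
  qed simp
  have "(i, j) \<in> (parcs (path_graph n))\<^sup>*" if "i < n" "j < n" for i j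
    using 0[OF that(1)] 0[OF that(2)] by (meson rtrancl_trans)
  then show ?thesis using assms unfolding connected_rtrancl_iff by (auto simp: path_graph_def)
qed

text \<open>Distinct vertices that are not consecutive are adjacent in the complement, and
  consecutive ones have a common neighbour there.\<close>

lemma connected_complement_path_graph:
  assumes "n \<ge> 5"
  shows "Digraph_Component.connected (with_proj (graph_complement (path_graph n)))"
proof -
  interpret C: pair_graph "graph_complement (path_graph n)"
    by (intro pair_graph_complement pair_graph_path_graph)
  let ?E = "parcs (graph_complement (path_graph n))"
  have E: "(i, j) \<in> ?E \<longleftrightarrow> i < n \<and> j < n \<and> i \<noteq> j \<and> j \<noteq> Suc i \<and> i \<noteq> Suc j" for i j
    by (auto simp: graph_complement_def path_graph_def)
  have consecutive: "\<exists>k. (i, k) \<in> ?E \<and> (k, Suc i) \<in> ?E" if "Suc i < n" for i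
  proof (cases "i + 3 < n")
    case True
    then show ?thesis by (intro exI[of _ "i + 3"]) (auto simp: E)
  next
    case False
    \<comment> \<open>Here \<open>i + 3\<close> is at least n, hence at least 5, so
      \<open>i - 2\<close> does not truncate and differs from \<open>i\<close> by 2 and from
      \<open>Suc i\<close> by 3.\<close>
    then show ?thesis using that assms by (intro exI[of _ "i - 2"]) (auto simp: E)
  qed
  have "(i, j) \<in> ?E\<^sup>*" if ij: "i < n" "j < n" for i j
  proof -
    consider "i = j" | "(i, j) \<in> ?E" | "j = Suc i" | "i = Suc j" using ij E by blast
    then show ?thesis
    proof cases
      case 3
      then show ?thesis using consecutive[of i] ij by (meson r_into_rtrancl rtrancl_trans)
    next
      case 4
      then show ?thesis using consecutive[of j] ij C.parcs_sym
        by (meson r_into_rtrancl rtrancl_trans)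
    qed auto
  qed
  moreover have "pverts (graph_complement (path_graph n)) = {..<n}"
    by (simp add: graph_complement_def path_graph_def)
  moreover have "0 \<in> {..<n}" using assms by simp
  ultimately show ?thesis unfolding C.connected_rtrancl_iff by auto
qed

text \<open>A discrete intermediate value property: one arc raises the vertex number by at most 1,
  so no value is skipped.\<close>

lemma vwalk_path_graph_visits:
  assumes "vwalk p (with_proj (path_graph n))" and "hd p \<le> m" and "m \<le> last p"
  shows "m \<in> set p"
  using assms
proof (induction p rule: vwalk_induct)
  case (Cons u v es)
  then have "v \<le> Suc u" by (auto simp: path_graph_def)
  then show ?case using Cons by (cases "m = u") auto
qed auto

text \<open>Any path from 0 to \<open>n - 1\<close> has all n - 2 vertices in between as internal
  vertices, and these need distinct colours.\<close>

lemma rvc_path_graph_ge: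
  assumes "n \<ge> 3"
  shows "n - 2 \<le> rvc (path_graph n)"
proof -
  let ?G = "path_graph n"
  have le: "n - 2 \<le> card (c ` pverts ?G)" if c: "rainbow_vertex_connected ?G c" for c
  proof -
    have "0 \<in> pverts ?G" "n - 1 \<in> pverts ?G" "0 \<noteq> n - 1" using assms by (auto simp: path_graph_def)
    then obtain p where p: "vpath p (with_proj ?G)" "hd p = 0" "last p = n - 1"
      and rainbow: "distinct (map c (butlast (tl p)))"
      using c unfolding rainbow_vertex_connected_def by blast
    have walk: "vwalk p (with_proj ?G)" using p(1) by auto
    have internal: "m \<in> set (butlast (tl p))" if m: "m \<in> {1..<n - 1}" for m
    proof -
      have "m \<in> set p" using vwalk_path_graph_visits[OF walk] p m by simp
      then have tl: "m \<in> set (tl p)" using p(2) m by (cases p) auto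
      then have ne: "tl p \<noteq> []" by auto
      then have "last (tl p) = n - 1" using p(3) by (simp add: last_tl)
      then have "tl p = butlast (tl p) @ [n - 1]" using append_butlast_last_id[OF ne] by simp
      then have "m \<in> set (butlast (tl p) @ [n - 1])" using tl by simp
      then show ?thesis using m by auto
    qed
    have "n - 2 = card {1..<n - 1}" by simp
    also have "\<dots> \<le> card (set (butlast (tl p)))" using internal by (intro card_mono) auto
    also have "\<dots> = card (c ` set (butlast (tl p)))"
      using rainbow by (simp add: distinct_map card_image)
    also have "\<dots> \<le> card (c ` pverts ?G)"
    proof (intro card_mono image_mono subsetI)
      fix x assume "x \<in> set (butlast (tl p))"
      then have "x \<in> set p" by (metis in_set_butlastD list.set_sel(2) tl_Nil)
      then show "x \<in> pverts ?G" using walk by (auto simp: vwalk_def)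
    qed (simp add: path_graph_def)
    finally show ?thesis .
  qed
  \<comment> \<open>The non-adjacent vertices 0 and 2 exclude the complete case, so
    \<open>rvc\<close> is the minimum, attained by some colouring to which \<open>le\<close>
    applies.\<close>
  have "(0, 2) \<notin> parcs ?G" "0 \<in> pverts ?G" "2 \<in> pverts ?G"
    using assms by (auto simp: path_graph_def)
  then have "\<not> complete_digraph (card (pverts ?G)) (with_proj ?G)"
    by (auto simp: complete_digraph_pair_def)
  then have "rvc ?G = (LEAST k. \<exists>c. card (c ` pverts ?G) = k \<and> rainbow_vertex_connected ?G c)"
    by (simp add: rvc_def)
  moreover obtain c where "rainbow_vertex_connected ?G c"
    using ex_rainbow_vertex_connected[OF pair_graph_path_graph connected_path_graph] assms
    by (metis gr0I not_numeral_le_zero)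
  ultimately have "\<exists>c. card (c ` pverts ?G) = rvc ?G \<and> rainbow_vertex_connected ?G c"
    using LeastI_ex[of "\<lambda>k. \<exists>c. card (c ` pverts ?G) = k \<and> rainbow_vertex_connected ?G c"] by auto
  then show ?thesis using le by metis
qed

text \<open>For the lower bound, the path contributes at least n - 2, and its complement at least 1
  because it is not complete.\<close>

lemma rvc_path_graph_add_complement:
  assumes "n \<ge> 5"
  shows "rvc (path_graph n) + rvc (graph_complement (path_graph n)) = n - 1"
proof (rule antisym)
  have conn: "Digraph_Component.connected (with_proj (path_graph n))"
    using assms by (intro connected_path_graph) simp
  show "rvc (path_graph n) + rvc (graph_complement (path_graph n)) \<le> n - 1"
    using rvc_add_rvc_complement_le[OF pair_graph_path_graph _ conn
        connected_complement_path_graph[OF assms]] assms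
    by (simp add: path_graph_def)
  have "0 \<in> pverts (path_graph n)" "1 \<in> pverts (path_graph n)"
    "(0, 1) \<notin> parcs (graph_complement (path_graph n))"
    using assms by (auto simp: path_graph_def graph_complement_def)
  then have "\<not> complete_digraph (card (pverts (graph_complement (path_graph n))))
      (with_proj (graph_complement (path_graph n)))"
    by (auto simp: complete_digraph_pair_def graph_complement_def)
  then have "rvc (graph_complement (path_graph n)) \<noteq> 0"
    using rvc_eq_0_iff[OF pair_graph_complement[OF pair_graph_path_graph]
        connected_complement_path_graph[OF assms]] by simp
  then show "n - 1 \<le> rvc (path_graph n) + rvc (graph_complement (path_graph n))"
    using rvc_path_graph_ge[of n] assms by simp
qed

theorem theorem2p3:
  fixes n :: nat
  assumes "n \<ge> 5"
  shows "(\<forall>G :: 'a pair_pre_digraph.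
            pair_graph G \<and> card (pverts G) = n \<and>
            Digraph_Component.connected (with_proj G) \<and>
            Digraph_Component.connected (with_proj (graph_complement G)) \<longrightarrow>
            rvc G + rvc (graph_complement G) \<le> n - 1) \<and>
         (\<exists>G :: nat pair_pre_digraph.
            pair_graph G \<and> card (pverts G) = n \<and>
            Digraph_Component.connected (with_proj G) \<and>
            Digraph_Component.connected (with_proj (graph_complement G)) \<and>
            rvc G + rvc (graph_complement G) = n - 1)"
proof (intro conjI)
  show "\<exists>G :: nat pair_pre_digraph.
      pair_graph G \<and> card (pverts G) = n \<and>
      Digraph_Component.connected (with_proj G) \<and>
      Digraph_Component.connected (with_proj (graph_complement G)) \<and>
      rvc G + rvc (graph_complement G) = n - 1"
    using assms pair_graph_path_graph connected_path_graph connected_complement_path_graph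
      rvc_path_graph_add_complement
    by (intro exI[of _ "path_graph n"]) (auto simp: path_graph_def)
qed (use rvc_add_rvc_complement_le assms in blast)

end
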